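(* Consider the quantized primal-dual algorithm under an arbitrary quantization scheme, and let $\boldsymbol{\epsilon}^{\boldsymbol{x}}_k=\boldsymbol{x}_k-\boldsymbol{x}^\star$, $\boldsymbol{\epsilon}^{\boldsymbol{\lambda}}_k=\boldsymbol{\lambda}_k-\boldsymbol{\lambda}^\star$. Then for every time $k$, $$\log\mathsf{E}\left[\|\boldsymbol{\epsilon}^{\boldsymbol{x}}_k\|_2^2\right]\ge\log\left(\frac{e^{1-\frac1M}}{2\pi e}\right)+\frac2M\left(\sum_{i=1}^M\sum_{n=0}^{k-1}\log\left(1+\mu_nU_i^{\min}\right)+\mathsf{h}[\boldsymbol{x}_0]-\sum_{t=0}^{k-1}\sum_{j=1}^N\log|\mathcal{A}^{\boldsymbol{\lambda}}_{j,t}|\right)$$ and $$\log\mathsf{E}\left[\|\boldsymbol{\epsilon}^{\boldsymbol{\lambda}}_k\|_2^2\right]\ge\log\left(\frac{e^{1-\frac1N}}{2\pi e}\right)+\frac2N\left(\mathsf{h}[\boldsymbol{\lambda}_0]-\sum_{t=0}^{k-1}\sum_{i=1}^M\log|\mathcal{A}^{\boldsymbol{x}}_{i,t}|\right).$$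
   Context: **Problem.** Let $N<M$ be positive integers, $A\in\mathbb{R}^{N\times M}$, $\boldsymbol{b}\in\mathbb{R}^N$, $U_i:\mathbb{R}\to\mathbb{R}$ ($1\le i\le M$). Consider: maximize $\sum_{i=1}^M U_i(x^i)$ over $\boldsymbol{x}=[x^1,\dots,x^M]^\top$ subject to $A\boldsymbol{x}=\boldsymbol{b}$. Let $\boldsymbol{x}^\star,\boldsymbol{\lambda}^\star$ be the optimal primal and dual solutions. $A_i$ is the $i$th column of $A$, $\bar A_j$ its $j$th row. **Quantization scheme.** At time $k\ge 0$, agent $i$ encodes $x^i_k$ into a symbol $\hat Q^{\boldsymbol{x}}_{i,k}=E^{\boldsymbol{x}}_{i,k}(\{x^i_n\}_{n=0}^k,\{\hat Q^{\boldsymbol{x}}_{i,n}\}_{n=0}^{k-1})$ in a finite alphabet $\mathcal{A}^{\boldsymbol{x}}_{i,k}$, and the quantized value is reconstructed as $Q^{\boldsymbol{x}}_{i,k}=D^{\boldsymbol{x}}_{i,k}(\{\hat Q^{\boldsymbol{x}}_{i,n}\}_{n=0}^k)$. Likewise, network node $j$ ($1\le j\le N$) encodes $\lambda^j_k$ into $\hat Q^{\boldsymbol{\lambda}}_{j,k}=E^{\boldsymbol{\lambda}}_{j,k}(\{\lambda^j_n\}_{n=0}^k,\{\hat Q^{\boldsymbol{\lambda}}_{j,n}\}_{n=0}^{k-1})$ in a finite alphabet $\mathcal{A}^{\boldsymbol{\lambda}}_{j,k}$, with reconstruction $Q^{\boldsymbol{\lambda}}_{j,k}=D^{\boldsymbol{\lambda}}_{j,k}(\{\hat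 Q^{\boldsymbol{\lambda}}_{j,n}\}_{n=0}^k)$. The collection $\mathcal{Q}$ of all these encoder and decoder maps is a quantization scheme. Write $Q^{\boldsymbol{x}}_k=[Q^{\boldsymbol{x}}_{1,k},\dots,Q^{\boldsymbol{x}}_{M,k}]^\top$, $Q^{\boldsymbol{\lambda}}_k=[Q^{\boldsymbol{\lambda}}_{1,k},\dots,Q^{\boldsymbol{\lambda}}_{N,k}]^\top$. **Quantized primal-dual (PD) algorithm.** For $k\ge1$, $$x^i_k=x^i_{k-1}+\mu_{k-1}\left(U_i'(x^i_{k-1})-A_i^\top Q^{\boldsymbol{\lambda}}_{k-1}\right),\qquad \lambda^j_k=\lambda^j_{k-1}+\mu_{k-1}\left(\bar A_jQ^{\boldsymbol{x}}_{k-1}-b_j\right).$$ The initial vectors $\boldsymbol{x}_0,\boldsymbol{\lambda}_0$ are random with densities $p_{\boldsymbol{x}_0},p_{\boldsymbol{\lambda}_0}$. **Standing assumptions.** (1) Each $U_i$ is concave and twice continuously differentiable. (2) There are constants with $U_i^{\min}\le U_i''(x)\le U_i^{\max}<0$ for all $x\in\mathbb{R}$ and all $i$. (3) $0<\mu_k\le\min_i 1/|U_i^{\min}|$ for all $k$. (4) $\mu_k\to\mu^\star>0$. (5) $\boldsymbol{x}_0$ and $\boldsymbol{\lambda}_0$ are independent and have finite differential entropies. Differential entropy: $\mathsf{h}[\boldsymbol{z}]=-\int p_{\boldsymbol{z}}\log p_{\boldsymbol{z}}$. Logarithms are natural, with $\log0=-\infty$. *)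

theory Defs
  imports "HOL-Probability.Probability"
begin

section \<open>The resource allocation problem\<close>

definition primal_optimal ::
  "real^'m^'n \<Rightarrow> real^'n \<Rightarrow> ('m \<Rightarrow> real \<Rightarrow> real) \<Rightarrow> real^'m \<Rightarrow> bool" where
  "primal_optimal A b U x \<longleftrightarrow>
     A *v x = b \<and>
     (\<forall>y. A *v y = b \<longrightarrow> (\<Sum>i\<in>UNIV. U i (y $ i)) \<le> (\<Sum>i\<in>UNIV. U i (x $ i)))"

text \<open>The sign of the multiplier term is the one for which the primal-dual iteration is
  gradient ascent in the primal and gradient descent in the dual variable.\<close>

definition lagrangian ::
  "real^'m^'n \<Rightarrow> real^'n \<Rightarrow> ('m \<Rightarrow> real \<Rightarrow> real) \<Rightarrow> real^'m \<Rightarrow> real^'n \<Rightarrow> real" where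
  "lagrangian A b U x l = (\<Sum>i\<in>UNIV. U i (x $ i)) - l \<bullet> (A *v x - b)"

definition dual_function ::
  "real^'m^'n \<Rightarrow> real^'n \<Rightarrow> ('m \<Rightarrow> real \<Rightarrow> real) \<Rightarrow> real^'n \<Rightarrow> ereal" where
  "dual_function A b U l = (SUP x. ereal (lagrangian A b U x l))"

definition dual_optimal ::
  "real^'m^'n \<Rightarrow> real^'n \<Rightarrow> ('m \<Rightarrow> real \<Rightarrow> real) \<Rightarrow> real^'n \<Rightarrow> bool" where
  "dual_optimal A b U l \<longleftrightarrow> (\<forall>l'. dual_function A b U l \<le> dual_function A b U l')"

definition twice_continuously_differentiable :: "(real \<Rightarrow> real) \<Rightarrow> bool" where
  "twice_continuously_differentiable f \<longleftrightarrow>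
     (\<forall>t. f differentiable (at t)) \<and>
     (\<forall>t. deriv f differentiable (at t)) \<and>
     continuous_on UNIV (deriv (deriv f))"


section \<open>Causal finite-alphabet quantizers\<close>

text \<open>A quantizer handles one scalar real sequence; a quantization scheme consists of one
  quantizer per agent and one per network node. Histories are extensional functions on the
  initial segments \<open>{..k}\<close> and \<open>{..<k}\<close>, so an encoder or decoder has no access to
  future data. Finite alphabets over arbitrary symbols are subsets of one symbol type.\<close>

record 's quantizer =
  alphabet :: "nat \<Rightarrow> 's set"
  encoder  :: "nat \<Rightarrow> (nat \<Rightarrow> real) \<Rightarrow> (nat \<Rightarrow> 's) \<Rightarrow> 's"
  decoder  :: "nat \<Rightarrow> (nat \<Rightarrow> 's) \<Rightarrow> real"

text \<open>Measurability of the encoders in the real history makes the iterates random variables.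
  It includes that the emitted symbol lies in the alphabet. Decoders act on a finite set and
  need no condition.\<close>

definition valid_quantizer :: "'s quantizer \<Rightarrow> bool" where
  "valid_quantizer q \<longleftrightarrow>
     (\<forall>k. finite (alphabet q k)) \<and>
     (\<forall>k. \<forall>s \<in> (\<Pi>\<^sub>E n\<in>{..<k}. alphabet q n).
        (\<lambda>z. encoder q k z s) \<in> (\<Pi>\<^sub>M n\<in>{..k}. borel) \<rightarrow>\<^sub>M count_space (alphabet q k))"

lemma restrict_fundef_cong [fundef_cong]:
  "I = J \<Longrightarrow> (\<And>i. i \<in> J \<Longrightarrow> f i = g i) \<Longrightarrow> restrict f I = restrict g J"
  by (auto simp: restrict_def fun_eq_iff)

fun symbol :: "'s quantizer \<Rightarrow> (nat \<Rightarrow> real) \<Rightarrow> nat \<Rightarrow> 's" where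
  "symbol q z k = encoder q k (\<lambda>n\<in>{..k}. z n) (\<lambda>n\<in>{..<k}. symbol q z n)"

declare symbol.simps [simp del]

definition quantized :: "'s quantizer \<Rightarrow> (nat \<Rightarrow> real) \<Rightarrow> nat \<Rightarrow> real" where
  "quantized q z k = decoder q k (\<lambda>n\<in>{..k}. symbol q z n)"


section \<open>The quantized primal-dual iteration\<close>

text \<open>The relation holds between a primal and a dual trajectory. Since \<open>quantized q z k\<close>
  depends only on \<open>z 0, \<dots>, z k\<close>, the initial values determine both trajectories.\<close>

definition quantized_primal_dual ::
  "real^'m^'n \<Rightarrow> real^'n \<Rightarrow> ('m \<Rightarrow> real \<Rightarrow> real) \<Rightarrow> (nat \<Rightarrow> real) \<Rightarrow>
   ('m \<Rightarrow> 's quantizer) \<Rightarrow> ('n \<Rightarrow> 't quantizer) \<Rightarrow>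
   (nat \<Rightarrow> real^'m) \<Rightarrow> (nat \<Rightarrow> real^'n) \<Rightarrow> bool" where
  "quantized_primal_dual A b U \<mu> qx ql x l \<longleftrightarrow>
     (\<forall>k. let Qx = (\<chi> i. quantized (qx i) (\<lambda>n. x n $ i) k);
              Ql = (\<chi> j. quantized (ql j) (\<lambda>n. l n $ j) k)
          in (\<forall>i. x (Suc k) $ i = x k $ i + \<mu> k * (deriv (U i) (x k $ i) - column i A \<bullet> Ql)) \<and>
             (\<forall>j. l (Suc k) $ j = l k $ j + \<mu> k * (row j A \<bullet> Qx - b $ j)))"


section \<open>Logarithm, entropy and independence\<close>

definition ext_ln :: "ennreal \<Rightarrow> ereal" where
  "ext_ln r = (if r = 0 then -\<infinity> else if r = \<infinity> then \<infinity> else ereal (ln (enn2real r)))"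

text \<open>The library entropy relative to Lebesgue measure is the differential entropy, here to
  base \<open>exp 1\<close>; \<open>finite_entropy\<close> says that the random variable has the given
  nonnegative density and that the integral below exists as a finite number.\<close>

lemma entropy_lborel_eq:
  fixes p :: "'a::euclidean_space \<Rightarrow> real"
  assumes "prob_space P" and "information_space.finite_entropy P (exp 1) lborel X p"
  shows "prob_space.entropy P (exp 1) lborel X = - (\<integral>z. p z * ln (p z) \<partial>lborel)"
proof -
  interpret prob_space P by fact
  interpret information_space P "exp 1" by unfold_locales simp
  have "log (exp 1) = (ln :: real \<Rightarrow> real)" by (simp add: fun_eq_iff log_def)
  then show ?thesis
    using assms(2) entropy_distr[of lborel X p] by (simp add: finite_entropy_def)
qed

text \<open>The library's \<open>indep_var\<close> requires both variables to have the same type.\<close>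

definition independent_vars ::
  "'w measure \<Rightarrow> ('w \<Rightarrow> 'a::topological_space) \<Rightarrow> ('w \<Rightarrow> 'b::topological_space) \<Rightarrow> bool" where
  "independent_vars P X Y \<longleftrightarrow>
     prob_space.indep_set P {X -` S \<inter> space P | S. S \<in> sets borel}
                            {Y -` S \<inter> space P | S. S \<in> sets borel}"

end

theory Submission
  imports Defs
begin

text \<open>
  The primal bound rests on a counting argument. The dual variables reach the primal iteration
  only through the symbols emitted before time \<open>k\<close>. Once such a word of symbols is fixed,
  \<open>x k\<close> is a deterministic function of \<open>x 0\<close>, and this function acts on each
  coordinate separately: step \<open>n\<close> is \<open>t \<mapsto> t + \<mu> n * (U' t - const)\<close>, with
  derivative at least \<open>1 + \<mu> n * Umin\<close>. So \<open>x k\<close> is always one of finitely many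
  images \<open>F s (x 0)\<close>, and each \<open>F s\<close> can shrink volume at most by the factor
  \<open>\<Prod>i. \<Prod>n<k. 1 + \<mu> n * Umin i\<close>. The dual iteration has the same form with vanishing
  \<open>U'\<close>, so there each \<open>F s\<close> is a translation.

  It remains to bound the mean square distance of such a variable from a fixed point. Let \<open>c\<close>
  be the volume factor, \<open>K\<close> the number of words, and \<open>D z\<close> the smallest squared
  distance of the points \<open>F s z\<close> from the given point. Then the square error is at least
  \<open>D (x 0)\<close>. A sum of \<open>K\<close> Gaussian integrals dominates the integral of
  \<open>exp (- D z / (2 * v))\<close>, so the latter is at most \<open>K / c\<close> times that of a single
  Gaussian (\<open>mse_lower_bound_of_finitely_many_maps\<close>). Normalised, this function is a
  subprobability density. Gibbs' inequality compares the density of \<open>x 0\<close> with it and bounds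
  the entropy of \<open>x 0\<close> by \<open>ln (K / c)\<close> plus the entropy of a Gaussian whose total
  variance is the mean of \<open>D (x 0)\<close> (\<open>mse_lower_bound_of_gaussian_integrals\<close>). The constant obtained in dimension \<open>d\<close> is
  \<open>d / (2 * pi * exp 1)\<close>, which is at least the stated one because
  \<open>ln d \<ge> 1 - 1 / d\<close>.

  If some factor \<open>1 + \<mu> n * Umin i\<close> vanishes, the primal bound is \<open>-\<infinity>\<close>.
\<close>

section \<open>The extended logarithm\<close>

lemma ext_ln_mono:
  assumes "r \<le> r'"
  shows "ext_ln r \<le> ext_ln r'"
proof (cases "r = 0 \<or> r' = \<infinity>")
  case True
  then show ?thesis by (auto simp: ext_ln_def)
next
  case False
  then have "0 < r" "r' < \<infinity>" "r < \<infinity>"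
    using assms by (auto simp: zero_less_iff_neq_zero less_top[symmetric] top_unique)
  then have "0 < enn2real r" "enn2real r \<le> enn2real r'"
    using assms by (auto simp: enn2real_positive_iff intro: enn2real_mono)
  then show ?thesis
    using False assms \<open>r < \<infinity>\<close> by (auto simp: ext_ln_def)
qed

lemma sum_ereal_eq_MInfty:
  fixes f :: "'i \<Rightarrow> ereal"
  assumes "finite I" "i \<in> I" "f i = -\<infinity>" "\<And>j. j \<in> I \<Longrightarrow> f j \<noteq> \<infinity>"
  shows "sum f I = -\<infinity>"
proof -
  have "sum f (I - {i}) \<noteq> \<infinity>" using assms by (subst sum_Pinfty) auto
  then show ?thesis using assms by (simp add: sum.remove[of I i])
qed

section \<open>Maximum entropy\<close>

text \<open>Normalising \<open>exp (- D z / (2 * v))\<close> gives a subprobability density \<open>q\<close>, and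
  Gibbs' inequality against the density of \<open>X\<close> yields
  \<open>h(X) \<le> ln V + d / 2 * ln (2 * pi * v) + E / (2 * v)\<close> with \<open>E\<close> the mean of
  \<open>D (X \<omega>)\<close>; the best choice is \<open>v = E / d\<close>. For \<open>V = 1\<close> and
  \<open>D\<close> the squared distance from a point this is the maximum entropy property of the
  Gaussian. The general \<open>D\<close> allows for errors that are not a function of \<open>X\<close> but
  are only bounded below by one.\<close>

lemma mse_lower_bound_of_gaussian_integrals:
  fixes X :: "'w \<Rightarrow> 'a::euclidean_space" and D :: "'a \<Rightarrow> real"
  assumes "prob_space P" and fe: "information_space.finite_entropy P (exp 1) lborel X p"
    and [measurable]: "D \<in> borel_measurable borel" and D0: "\<And>z. 0 \<le> D z"
    and V: "0 < V"
    and gauss: "\<And>v. 0 < v \<Longrightarrow>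
      (\<integral>\<^sup>+z. ennreal (exp (- D z / (2 * v))) \<partial>lborel) \<le> ennreal (V * sqrt (2 * pi * v) ^ DIM('a))"
  shows "ereal (ln (real DIM('a) / (2 * pi * exp 1)) +
           2 / real DIM('a) * (prob_space.entropy P (exp 1) lborel X - ln V))
         \<le> ext_ln (\<integral>\<^sup>+\<omega>. ennreal (D (X \<omega>)) \<partial>P)"
proof -
  interpret prob_space P by fact
  interpret information_space P "exp 1" by unfold_locales simp
  define d where "d = real DIM('a)"
  define h where "h = entropy (exp 1) lborel X"
  define E where "E = (\<integral>\<^sup>+\<omega>. ennreal (D (X \<omega>)) \<partial>P)"
  have d: "0 < d" by (simp add: d_def)
  have h: "h = - (\<integral>z. p z * ln (p z) \<partial>lborel)"
    unfolding h_def by (rule entropy_lborel_eq) fact+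
  have dist: "distributed P lborel X p"
    and p0: "\<And>z. 0 \<le> p z" and [measurable]: "p \<in> borel_measurable borel"
    and pln: "integrable lborel (\<lambda>z. p z * ln (p z))"
    using fe finite_entropy_measurable[OF fe]
    by (auto simp: finite_entropy_def log_def)
  have Ep: "E = (\<integral>\<^sup>+z. ennreal (p z * D z) \<partial>lborel)"
    unfolding E_def by (subst distributed_nn_integral[OF dist, symmetric])
      (auto simp: ennreal_mult p0 D0)
  have "(\<integral>\<^sup>+z. ennreal (p z) \<partial>lborel) = 1"
    using distributed_nn_integral[OF dist, of "\<lambda>_. 1"] by (simp add: emeasure_space_1)
  then have p: "has_bochner_integral lborel p 1"
    by (intro has_bochner_integral_nn_integral) (auto simp: p0)
  show ?thesis
  proof (cases "E = \<infinity>")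
    case True
    then show ?thesis by (simp add: E_def ext_ln_def)
  next
    case False
    define e where "e = enn2real E"
    have e0: "0 \<le> e" by (simp add: e_def)
    have Ee: "E = ennreal e" using False by (simp add: e_def less_top)
    have pD: "has_bochner_integral lborel (\<lambda>z. p z * D z) e"
      using Ep Ee e0 by (intro has_bochner_integral_nn_integral) (auto simp: p0 D0)
    have key: "h \<le> ln V + d / 2 * ln (2 * pi * v) + e / (2 * v)" if v: "0 < v" for v
    proof -
      define G where "G = V * sqrt (2 * pi * v) ^ DIM('a)"
      have G: "0 < G" using V v by (simp add: G_def)
      have lnG: "ln G = ln V + d / 2 * ln (2 * pi * v)"
        using V v by (simp add: G_def ln_mult ln_realpow ln_sqrt d_def)
      define q where "q z = exp (- D z / (2 * v)) / G" for z
      have q0: "0 \<le> q z" for z using G by (simp add: q_def)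
      have q: "integrable lborel q" "(\<integral>z. q z \<partial>lborel) \<le> 1"
      proof -
        have "(\<integral>\<^sup>+z. ennreal (q z) \<partial>lborel)
            = (\<integral>\<^sup>+z. ennreal (exp (- D z / (2 * v))) * ennreal (1 / G) \<partial>lborel)"
          using G by (intro nn_integral_cong) (simp add: q_def ennreal_mult[symmetric])
        also have "\<dots> = (\<integral>\<^sup>+z. ennreal (exp (- D z / (2 * v))) \<partial>lborel) * ennreal (1 / G)"
          by (rule nn_integral_multc) simp
        also have "\<dots> \<le> ennreal G * ennreal (1 / G)"
          using gauss[OF v] by (intro mult_right_mono) (auto simp: G_def)
        also have "\<dots> = 1" using G by (simp add: ennreal_mult[symmetric])
        finally have le1: "(\<integral>\<^sup>+z. ennreal (q z) \<partial>lborel) \<le> 1" .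
        show int: "integrable lborel q"
        proof (rule integrableI_bounded)
          show "q \<in> borel_measurable lborel" by (simp add: q_def[abs_def])
          show "(\<integral>\<^sup>+z. ennreal (norm (q z)) \<partial>lborel) < \<infinity>"
            using le1 G by (auto simp: q_def abs_of_pos intro: le_less_trans)
        qed
        show "(\<integral>z. q z \<partial>lborel) \<le> 1"
          using le1 nn_integral_eq_integral[OF int] q0 by simp
      qed
      \<comment> \<open>The pointwise form of Gibbs' inequality, \<open>p - q + p * ln q \<le> p * ln p\<close>: with \<open>ln q\<close> written out, so that every term on the left is visibly integrable.\<close>
      have pw: "p z * 1 - q z - ln G * p z - p z * D z / (2 * v) \<le> p z * ln (p z)" for z
      proof (cases "p z = 0")
        case True
        then show ?thesis using G by (simp add: q_def)
      next
        case False
        then have pz: "0 < p z" using p0[of z] by simp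
        have qz: "0 < q z" using G by (simp add: q_def)
        have "ln (q z / p z) \<le> q z / p z - 1" using pz qz by (intro ln_le_minus_one) simp
        then have "p z * ln (q z / p z) \<le> p z * (q z / p z - 1)"
          using pz by (intro mult_left_mono) auto
        also have "\<dots> = q z - p z" using pz by (simp add: field_simps)
        finally have "p z * (ln (q z) - ln (p z)) \<le> q z - p z"
          using pz qz by (simp add: ln_div)
        moreover have "ln (q z) = - D z / (2 * v) - ln G"
          using G by (simp add: q_def ln_div)
        ultimately show ?thesis by (simp add: algebra_simps)
      qed
      have ip: "integrable lborel p" "(\<integral>z. p z \<partial>lborel) = 1"
        and ipD: "integrable lborel (\<lambda>z. p z * D z)" "(\<integral>z. p z * D z \<partial>lborel) = e"
        using p pD by (auto simp: has_bochner_integral_iff)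
      have "1 - (\<integral>z. q z \<partial>lborel) - ln G - e / (2 * v)
          = (\<integral>z. p z * 1 - q z - ln G * p z - p z * D z / (2 * v) \<partial>lborel)"
        using ip ipD q by simp
      also have "\<dots> \<le> (\<integral>z. p z * ln (p z) \<partial>lborel)"
        using ip ipD q pln by (intro integral_mono pw) auto
      finally show ?thesis using q h lnG by simp
    qed
    \<comment> \<open>For \<open>e = 0\<close> the bound would hold without its last term, but its right-hand side tends
      to \<open>-\<infinity>\<close> as \<open>v\<close> tends to 0; the \<open>v\<close> below puts it at
      \<open>h - 1\<close>.\<close>
    have epos: "0 < e"
    proof (rule ccontr)
      assume "\<not> 0 < e"
      then have "e = 0" using e0 by simp
      define v where "v = exp (2 / d * (h - ln V - 1)) / (2 * pi)"
      have v: "0 < v" by (simp add: v_def)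
      have ln_v: "d / 2 * ln (2 * pi * v) = h - ln V - 1"
        using d by (simp add: v_def)
      have "h \<le> ln V + (h - ln V - 1) + 0 / (2 * v)"
        using key[OF v] unfolding ln_v \<open>e = 0\<close> .
      then show False by simp
    qed
    have "h \<le> ln V + d / 2 * ln (2 * pi * (e / d)) + d / 2"
      using key[of "e / d"] epos d by simp
    then have "h - ln V \<le> d / 2 * (ln (2 * pi * (e / d)) + 1)" by (simp add: algebra_simps)
    then have "2 / d * (h - ln V) \<le> 2 / d * (d / 2 * (ln (2 * pi * (e / d)) + 1))"
      using d by (intro mult_left_mono) auto
    also have "\<dots> = ln (2 * pi * (e / d)) + 1" using d by simp
    finally have "ln (d / (2 * pi * exp 1)) + 2 / d * (h - ln V) \<le> ln e"
      using d epos by (simp add: ln_div ln_mult)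
    then show ?thesis
      using epos Ee by (simp add: E_def[symmetric] ext_ln_def h_def d_def)
  qed
qed

section \<open>Maps that stretch the real line\<close>

text \<open>For \<open>c > 0\<close> this says that Lebesgue measure transported by \<open>f\<close> is at most \<open>1 / c\<close> times
  Lebesgue measure. The integral form composes without the chain rule or inverse functions.\<close>

definition stretches :: "real \<Rightarrow> (real \<Rightarrow> real) \<Rightarrow> bool" where
  "stretches c f \<longleftrightarrow> f \<in> borel_measurable borel \<and>
     (\<forall>g \<in> borel_measurable borel. ennreal c * (\<integral>\<^sup>+t. g (f t) \<partial>lborel) \<le> (\<integral>\<^sup>+t. g t \<partial>lborel))"

lemma stretchesD:
  assumes "stretches c f"
  shows "f \<in> borel_measurable borel"
    and "g \<in> borel_measurable borel \<Longrightarrow>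
      ennreal c * (\<integral>\<^sup>+t. g (f t) \<partial>lborel) \<le> (\<integral>\<^sup>+t. g t \<partial>lborel)"
  using assms by (auto simp: stretches_def)

lemma stretches_id: "stretches 1 (\<lambda>t. t)"
  by (simp add: stretches_def)

lemma stretches_compose:
  assumes f: "stretches c f" and g: "stretches c' g" and "0 \<le> c" "0 \<le> c'"
  shows "stretches (c * c') (\<lambda>t. g (f t))"
  unfolding stretches_def
proof (intro conjI ballI)
  note [measurable] = stretchesD(1)[OF f] stretchesD(1)[OF g]
  show "(\<lambda>t. g (f t)) \<in> borel_measurable borel" by simp
  fix u :: "real \<Rightarrow> ennreal" assume [measurable]: "u \<in> borel_measurable borel"
  have "ennreal (c * c') * (\<integral>\<^sup>+t. u (g (f t)) \<partial>lborel)
      = ennreal c' * (ennreal c * (\<integral>\<^sup>+t. u (g (f t)) \<partial>lborel))"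
    using assms by (simp add: ennreal_mult mult_ac)
  also have "\<dots> \<le> ennreal c' * (\<integral>\<^sup>+t. u (g t) \<partial>lborel)"
    using stretchesD(2)[OF f, of "\<lambda>t. u (g t)"] by (intro mult_left_mono) auto
  also have "\<dots> \<le> (\<integral>\<^sup>+t. u t \<partial>lborel)" by (rule stretchesD(2)[OF g]) simp
  finally show "ennreal (c * c') * (\<integral>\<^sup>+t. u (g (f t)) \<partial>lborel) \<le> (\<integral>\<^sup>+t. u t \<partial>lborel)" .
qed

text \<open>On each bounded interval, replace \<open>c\<close> by \<open>f'\<close> and substitute; then exhaust the
  line.\<close>

lemma stretches_of_deriv:
  fixes f f' :: "real \<Rightarrow> real"
  assumes deriv: "\<And>t. (f has_real_derivative f' t) (at t)" and cont: "continuous_on UNIV f'"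
    and c: "0 \<le> c" "\<And>t. c \<le> f' t"
  shows "stretches c f"
  unfolding stretches_def
proof (intro conjI ballI)
  show [measurable]: "f \<in> borel_measurable borel"
    using deriv by (intro borel_measurable_continuous_onI)
      (auto intro: DERIV_isCont simp: continuous_on_eq_continuous_at)
  fix g :: "real \<Rightarrow> ennreal" assume [measurable]: "g \<in> borel_measurable borel"
  \<comment> \<open>With \<open>Suc n\<close> the intervals are nondegenerate, as the substitution rule requires.\<close>
  define I where "I n = {- real (Suc n) .. real (Suc n)}" for n
  have "ennreal c * (\<integral>\<^sup>+t. g (f t) \<partial>lborel) = (\<integral>\<^sup>+t. ennreal c * g (f t) \<partial>lborel)"
    by (rule nn_integral_cmult[symmetric]) simp
  also have "\<dots> = (\<integral>\<^sup>+t. (SUP n. ennreal c * g (f t) * indicator (I n) t) \<partial>lborel)"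
  proof (intro nn_integral_cong)
    fix t :: real
    obtain n where "\<bar>t\<bar> \<le> real n" using real_arch_simple by blast
    then have "t \<in> I n" by (auto simp: I_def)
    then show "ennreal c * g (f t) = (SUP n. ennreal c * g (f t) * indicator (I n) t)"
      by (intro antisym SUP_least) (auto intro!: SUP_upper2[of n] split: split_indicator)
  qed
  also have "\<dots> = (SUP n. \<integral>\<^sup>+t. ennreal c * g (f t) * indicator (I n) t \<partial>lborel)"
    by (intro nn_integral_monotone_convergence_SUP)
      (auto simp: incseq_def le_fun_def I_def split: split_indicator)
  also have "\<dots> \<le> (\<integral>\<^sup>+t. g t \<partial>lborel)"
  proof (rule SUP_least)
    fix n :: nat
    show "(\<integral>\<^sup>+t. ennreal c * g (f t) * indicator (I n) t \<partial>lborel) \<le> (\<integral>\<^sup>+t. g t \<partial>lborel)"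
    proof -
      have "(\<integral>\<^sup>+t. ennreal c * g (f t) * indicator (I n) t \<partial>lborel)
          \<le> (\<integral>\<^sup>+t. g (f t) * ennreal (f' t) * indicator (I n) t \<partial>lborel)"
        using c by (intro nn_integral_mono)
          (auto split: split_indicator simp: mult.commute intro!: mult_right_mono ennreal_leI)
      also have "\<dots> = (\<integral>\<^sup>+t. g t * indicator {f (- real (Suc n))..f (real (Suc n))} t \<partial>lborel)"
        unfolding I_def using c
        by (intro nn_integral_substitution_aux[symmetric] deriv continuous_on_subset[OF cont])
          (auto intro: order_trans)
      also have "\<dots> \<le> (\<integral>\<^sup>+t. g t \<partial>lborel)"
        by (intro nn_integral_mono) (auto split: split_indicator)
      finally show ?thesis .
    qed
  qed
  finally show "ennreal c * (\<integral>\<^sup>+t. g (f t) \<partial>lborel) \<le> (\<integral>\<^sup>+t. g t \<partial>lborel)" .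
qed

lemma gaussian_integral_stretched:
  assumes f: "stretches c f" and "0 < c" "0 < v"
  shows "(\<integral>\<^sup>+t. ennreal (exp (- (f t - a)\<^sup>2 / (2 * v))) \<partial>lborel) \<le> ennreal (sqrt (2 * pi * v) / c)"
proof -
  note [measurable] = stretchesD(1)[OF f]
  have "(\<integral>\<^sup>+t. ennreal (exp (- (t - a)\<^sup>2 / (2 * v))) \<partial>lborel)
      = (\<integral>\<^sup>+t. ennreal (sqrt (2 * pi * v)) * ennreal (normal_density a (sqrt v) t) \<partial>lborel)"
    using \<open>0 < v\<close> by (intro nn_integral_cong) (simp add: normal_density_def ennreal_mult[symmetric])
  also have "\<dots> = ennreal (sqrt (2 * pi * v)) * (\<integral>\<^sup>+t. ennreal (normal_density a (sqrt v) t) \<partial>lborel)"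
    by (rule nn_integral_cmult) simp
  also have "(\<integral>\<^sup>+t. ennreal (normal_density a (sqrt v) t) \<partial>lborel) = 1"
    using \<open>0 < v\<close> by (subst nn_integral_eq_integral) auto
  finally have G: "(\<integral>\<^sup>+t. ennreal (exp (- (t - a)\<^sup>2 / (2 * v))) \<partial>lborel) = ennreal (sqrt (2 * pi * v))"
    by simp
  let ?I = "\<integral>\<^sup>+t. ennreal (exp (- (f t - a)\<^sup>2 / (2 * v))) \<partial>lborel"
  have le: "ennreal c * ?I \<le> ennreal (sqrt (2 * pi * v))"
    using stretchesD(2)[OF f, of "\<lambda>t. ennreal (exp (- (t - a)\<^sup>2 / (2 * v)))"] G by simp
  have "?I = ennreal (1 / c) * (ennreal c * ?I)"
    using \<open>0 < c\<close> by (simp add: mult.assoc[symmetric] ennreal_mult[symmetric])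
  also have "\<dots> \<le> ennreal (1 / c) * ennreal (sqrt (2 * pi * v))"
    by (intro mult_left_mono le) simp
  also have "\<dots> = ennreal (sqrt (2 * pi * v) / c)"
    using \<open>0 < c\<close> \<open>0 < v\<close> by (simp add: ennreal_mult[symmetric])
  finally show ?thesis .
qed

section \<open>Finitely many coordinatewise maps\<close>

lemma nn_integral_lborel_prod_vec:
  fixes f :: "'m::finite \<Rightarrow> real \<Rightarrow> ennreal"
  assumes [measurable]: "\<And>i. f i \<in> borel_measurable borel"
  shows "(\<integral>\<^sup>+z. (\<Prod>i\<in>UNIV. f i (z $ i)) \<partial>(lborel :: (real^'m) measure))
       = (\<Prod>i\<in>UNIV. \<integral>\<^sup>+t. f i t \<partial>lborel)"
proof -
  have inj: "inj (\<lambda>i::'m. axis i (1::real))"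
    by (auto simp: inj_on_def axis_eq_axis)
  have B: "(Basis :: (real^'m) set) = range (\<lambda>i. axis i 1)"
    by (auto simp: Basis_vec_def)
  define ix where "ix = inv (\<lambda>i::'m. axis i (1::real))"
  have ix: "ix (axis i 1) = i" for i
    unfolding ix_def by (rule inv_f_f[OF inj])
  have "(\<integral>\<^sup>+z. (\<Prod>i\<in>UNIV. f i (z $ i)) \<partial>(lborel :: (real^'m) measure))
      = (\<integral>\<^sup>+z. (\<Prod>b\<in>Basis. f (ix b) (z \<bullet> b)) \<partial>(lborel :: (real^'m) measure))"
    by (simp add: B prod.reindex[OF inj] ix inner_axis)
  also have "\<dots> = (\<Prod>b\<in>(Basis :: (real^'m) set). \<integral>\<^sup>+t. f (ix b) t \<partial>lborel)"
    by (rule nn_integral_lborel_prod) auto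
  also have "\<dots> = (\<Prod>i\<in>UNIV. \<integral>\<^sup>+t. f i t \<partial>lborel)"
    by (simp add: B prod.reindex[OF inj] ix)
  finally show ?thesis .
qed

lemma norm_vec_diff_squared:
  fixes z a :: "real^'m"
  shows "(norm (z - a))\<^sup>2 = (\<Sum>i\<in>UNIV. (z $ i - a $ i)\<^sup>2)"
  unfolding power2_norm_eq_inner by (simp add: inner_vec_def power2_eq_square)

text \<open>The index \<open>s\<close> of the map that produces \<open>Y \<omega>\<close> varies with \<open>\<omega>\<close>. Passing
  to the index with the smallest error removes this dependence: the squared error is at least a
  measurable function \<open>D\<close> of \<open>X\<close> alone. The price for this choice is the
  factor \<open>card S\<close>, because the maximum \<open>exp (- D z / (2 * v))\<close> is bounded by the sum
  of the Gaussians over all indices.\<close>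

lemma mse_lower_bound_of_finitely_many_maps:
  fixes X Y :: "'w \<Rightarrow> real^'m" and f :: "'s \<Rightarrow> 'm \<Rightarrow> real \<Rightarrow> real" and a :: "real^'m"
  assumes "prob_space P" and fe: "information_space.finite_entropy P (exp 1) lborel X p"
    and S: "finite S" and c: "\<And>i. 0 < c i"
    and f: "\<And>s i. s \<in> S \<Longrightarrow> stretches (c i) (f s i)"
    and Y: "\<And>\<omega>. \<omega> \<in> space P \<Longrightarrow> \<exists>s\<in>S. \<forall>i. Y \<omega> $ i = f s i (X \<omega> $ i)"
  shows "ereal (ln (real CARD('m) / (2 * pi * exp 1)) +
           2 / real CARD('m) *
             ((\<Sum>i\<in>UNIV. ln (c i)) + prob_space.entropy P (exp 1) lborel X - ln (real (card S))))
         \<le> ext_ln (\<integral>\<^sup>+\<omega>. ennreal ((norm (Y \<omega> - a))\<^sup>2) \<partial>P)"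
proof -
  interpret prob_space P by fact
  have Sne: "S \<noteq> {}" using Y not_empty by blast
  define g where "g s z = (\<Sum>i\<in>UNIV. (f s i (z $ i) - a $ i)\<^sup>2)" for s and z :: "real^'m"
  define D where "D z = (MIN s\<in>S. g s z)" for z
  define V where "V = real (card S) / (\<Prod>i\<in>UNIV. c i)"
  have [measurable]: "f s i \<in> borel_measurable borel" if "s \<in> S" for s i
    using stretchesD(1)[OF f[OF that]] .
  have g_meas[measurable]: "g s \<in> borel_measurable borel" if "s \<in> S" for s
    using that unfolding g_def by measurable
  have D_in: "\<exists>s\<in>S. D z = g s z" for z
  proof -
    have "D z \<in> (\<lambda>s. g s z) ` S" unfolding D_def using S Sne by (intro Min_in) auto
    then show ?thesis by blast
  qed
  have D_le: "D z \<le> g s z" if "s \<in> S" for s z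
    unfolding D_def using S that by (intro Min_le) auto
  have D0: "0 \<le> D z" for z
    using D_in[of z] by (auto simp: g_def intro!: sum_nonneg)
  have [measurable]: "D \<in> borel_measurable borel"
    unfolding D_def using S Sne by (intro borel_measurable_Min) auto
  have V: "0 < V" using S Sne c by (auto simp: V_def card_gt_0_iff intro!: divide_pos_pos prod_pos)
  have single: "(\<integral>\<^sup>+z. ennreal (exp (- g s z / (2 * v))) \<partial>lborel)
      \<le> ennreal (sqrt (2 * pi * v) ^ CARD('m) / (\<Prod>i\<in>UNIV. c i))" if "s \<in> S" "0 < v" for s v
  proof -
    have "(\<integral>\<^sup>+z. ennreal (exp (- g s z / (2 * v))) \<partial>lborel)
        = (\<integral>\<^sup>+z. (\<Prod>i\<in>UNIV. ennreal (exp (- (f s i (z $ i) - a $ i)\<^sup>2 / (2 * v)))) \<partial>lborel)"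
      by (intro nn_integral_cong)
        (simp add: g_def prod_ennreal exp_sum[symmetric] sum_negf sum_divide_distrib)
    also have "\<dots> = (\<Prod>i\<in>UNIV. \<integral>\<^sup>+t. ennreal (exp (- (f s i t - a $ i)\<^sup>2 / (2 * v))) \<partial>lborel)"
      using that by (intro nn_integral_lborel_prod_vec) simp
    also have "\<dots> \<le> (\<Prod>i\<in>UNIV. ennreal (sqrt (2 * pi * v) / c i))"
      using that by (intro prod_mono_ennreal gaussian_integral_stretched f c) auto
    also have "\<dots> = ennreal (sqrt (2 * pi * v) ^ CARD('m) / (\<Prod>i\<in>UNIV. c i))"
      using that c by (subst prod_ennreal) (auto simp: prod_dividef less_imp_le)
    finally show ?thesis .
  qed
  have gauss: "(\<integral>\<^sup>+z. ennreal (exp (- D z / (2 * v))) \<partial>lborel)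
      \<le> ennreal (V * sqrt (2 * pi * v) ^ DIM(real^'m))" if v: "0 < v" for v
  proof -
    have "(\<integral>\<^sup>+z. ennreal (exp (- D z / (2 * v))) \<partial>lborel)
        \<le> (\<integral>\<^sup>+z. (\<Sum>s\<in>S. ennreal (exp (- g s z / (2 * v)))) \<partial>lborel)"
    proof (intro nn_integral_mono)
      fix z
      obtain s where "s \<in> S" "D z = g s z" using D_in by blast
      then show "ennreal (exp (- D z / (2 * v))) \<le> (\<Sum>s\<in>S. ennreal (exp (- g s z / (2 * v))))"
        using S by (auto simp del: sum_ennreal intro!: member_le_sum)
    qed
    also have "\<dots> = (\<Sum>s\<in>S. \<integral>\<^sup>+z. ennreal (exp (- g s z / (2 * v))) \<partial>lborel)"
      by (intro nn_integral_sum) simp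
    also have "\<dots> \<le> (\<Sum>s\<in>S. ennreal (sqrt (2 * pi * v) ^ CARD('m) / (\<Prod>i\<in>UNIV. c i)))"
      by (intro sum_mono single v)
    also have "\<dots> = ennreal (V * sqrt (2 * pi * v) ^ DIM(real^'m))"
      using c v by (simp add: V_def ennreal_of_nat_eq_real_of_nat ennreal_mult[symmetric]
          prod_nonneg less_imp_le)
    finally show ?thesis .
  qed
  have "(\<integral>\<^sup>+\<omega>. ennreal (D (X \<omega>)) \<partial>P) \<le> (\<integral>\<^sup>+\<omega>. ennreal ((norm (Y \<omega> - a))\<^sup>2) \<partial>P)"
  proof (intro nn_integral_mono ennreal_leI)
    fix \<omega> assume "\<omega> \<in> space P"
    then obtain s where "s \<in> S" "\<And>i. Y \<omega> $ i = f s i (X \<omega> $ i)" using Y by blast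
    then show "D (X \<omega>) \<le> (norm (Y \<omega> - a))\<^sup>2"
      using D_le[of s "X \<omega>"] by (simp add: g_def norm_vec_diff_squared)
  qed
  then have mono: "ext_ln (\<integral>\<^sup>+\<omega>. ennreal (D (X \<omega>)) \<partial>P)
      \<le> ext_ln (\<integral>\<^sup>+\<omega>. ennreal ((norm (Y \<omega> - a))\<^sup>2) \<partial>P)"
    by (rule ext_ln_mono)
  have lnV: "ln V = ln (real (card S)) - (\<Sum>i\<in>UNIV. ln (c i))"
    using S Sne c
    by (simp add: V_def ln_div card_gt_0_iff prod_pos ln_prod less_imp_neq[symmetric])
  show ?thesis
    using mse_lower_bound_of_gaussian_integrals[OF \<open>prob_space P\<close> fe _ D0 V gauss] mono
    by (simp add: lnV algebra_simps)
qed

section \<open>Symbol words and trajectories\<close>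

lemma symbol_in_alphabet:
  assumes "valid_quantizer q"
  shows "symbol q z n \<in> alphabet q n"
proof (induction n rule: less_induct)
  case (less n)
  let ?s = "\<lambda>m\<in>{..<n}. symbol q z m"
  have "?s \<in> (\<Pi>\<^sub>E m\<in>{..<n}. alphabet q m)" using less by auto
  then have "(\<lambda>y. encoder q n y ?s) \<in> (\<Pi>\<^sub>M m\<in>{..n}. borel) \<rightarrow>\<^sub>M count_space (alphabet q n)"
    using assms by (auto simp: valid_quantizer_def)
  moreover have "(\<lambda>m\<in>{..n}. z m) \<in> space (\<Pi>\<^sub>M m\<in>{..n}. (borel :: real measure))"
    by (auto simp: space_PiM)
  ultimately have "encoder q n (\<lambda>m\<in>{..n}. z m) ?s \<in> space (count_space (alphabet q n))"
    by (rule measurable_space)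
  then show ?case by (subst symbol.simps) simp
qed

text \<open>Words are extensional, so that their number is exactly the product of the alphabet sizes.\<close>

definition words :: "('j \<Rightarrow> 's quantizer) \<Rightarrow> nat \<Rightarrow> ('j \<Rightarrow> nat \<Rightarrow> 's) set" where
  "words q k = (\<Pi>\<^sub>E j\<in>UNIV. \<Pi>\<^sub>E t\<in>{..<k}. alphabet (q j) t)"

definition decoded :: "('j \<Rightarrow> 's quantizer) \<Rightarrow> ('j \<Rightarrow> nat \<Rightarrow> 's) \<Rightarrow> nat \<Rightarrow> real^'j" where
  "decoded q s t = (\<chi> j. decoder (q j) t (\<lambda>m\<in>{..t}. s j m))"

lemma finite_words:
  fixes q :: "'j::finite \<Rightarrow> 's quantizer"
  assumes "\<And>j. valid_quantizer (q j)"
  shows "finite (words q k)"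
  using assms by (auto simp: words_def valid_quantizer_def intro!: finite_PiE)

lemma ln_card_words:
  fixes q :: "'j::finite \<Rightarrow> 's quantizer"
  assumes q: "\<And>j. valid_quantizer (q j)"
  shows "ln (real (card (words q k))) = (\<Sum>t<k. \<Sum>j\<in>UNIV. ln (real (card (alphabet (q j) t))))"
proof -
  have pos: "0 < card (alphabet (q j) t)" for j t
    using symbol_in_alphabet[OF q, of j _ t] q[of j] by (auto simp: card_gt_0_iff valid_quantizer_def)
  have "card (words q k) = (\<Prod>j\<in>UNIV. \<Prod>t<k. card (alphabet (q j) t))"
    by (simp add: words_def card_PiE)
  also have "\<dots> = (\<Prod>t<k. \<Prod>j\<in>UNIV. card (alphabet (q j) t))" by (rule prod.swap)
  finally show ?thesis
    using pos by (simp add: ln_prod prod_pos)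
qed

text \<open>The word consists of the symbols actually emitted, so it depends on the trajectory; what matters
  is that it ranges over a finite set and determines all reconstructed values before time
  \<open>k\<close>.\<close>

lemma quantized_eq_decoded_word:
  fixes q :: "'j::finite \<Rightarrow> 's quantizer" and z :: "nat \<Rightarrow> real^'j"
  assumes "\<And>j. valid_quantizer (q j)"
  shows "\<exists>s\<in>words q k. \<forall>t<k. (\<chi> j. quantized (q j) (\<lambda>n. z n $ j) t) = decoded q s t"
proof (intro bexI allI impI)
  let ?s = "\<lambda>j. \<lambda>t\<in>{..<k}. symbol (q j) (\<lambda>n. z n $ j) t"
  show "?s \<in> words q k"
    by (simp add: words_def PiE_iff symbol_in_alphabet[OF assms])
  fix t assume "t < k"
  then have "(\<lambda>m\<in>{..t}. ?s j m) = (\<lambda>m\<in>{..t}. symbol (q j) (\<lambda>n. z n $ j) m)" for j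
    by (auto simp: restrict_def fun_eq_iff)
  then show "(\<chi> j. quantized (q j) (\<lambda>n. z n $ j) t) = decoded q ?s t"
    by (simp only: quantized_def decoded_def)
qed

text \<open>One coordinate of the primal or dual iteration as a function of its initial value, when the
  received signal \<open>r\<close> is held fixed.\<close>

primrec driven :: "(nat \<Rightarrow> real) \<Rightarrow> (real \<Rightarrow> real) \<Rightarrow> (nat \<Rightarrow> real) \<Rightarrow> nat \<Rightarrow> real \<Rightarrow> real" where
  "driven \<mu> v r 0 t = t"
| "driven \<mu> v r (Suc n) t = driven \<mu> v r n t + \<mu> n * (v (driven \<mu> v r n t) - r n)"

lemma driven_unique:
  assumes "\<And>n. n < k \<Longrightarrow> y (Suc n) = y n + \<mu> n * (v (y n) - r n)"
  shows "y k = driven \<mu> v r k (y 0)"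
  using assms by (induction k) auto

lemma stretches_driven:
  assumes v: "\<And>t. (v has_real_derivative v' t) (at t)" "continuous_on UNIV v'"
    and c: "\<And>n. n < k \<Longrightarrow> 0 \<le> c n" "\<And>n t. n < k \<Longrightarrow> c n \<le> 1 + \<mu> n * v' t"
  shows "stretches (\<Prod>n<k. c n) (driven \<mu> v r k)"
  using c
proof (induction k)
  case 0
  then show ?case using stretches_id by simp
next
  case (Suc k)
  have step: "stretches (c k) (\<lambda>t. t + \<mu> k * (v t - r k))"
  proof (rule stretches_of_deriv)
    show "((\<lambda>t. t + \<mu> k * (v t - r k)) has_real_derivative 1 + \<mu> k * v' t) (at t)" for t
      by (auto intro!: derivative_eq_intros v(1))
    show "continuous_on UNIV (\<lambda>t. 1 + \<mu> k * v' t)"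
      by (intro continuous_intros v(2))
  qed (use Suc.prems in auto)
  have "stretches (\<Prod>n<k. c n) (driven \<mu> v r k)"
    using Suc by simp
  moreover have "0 \<le> (\<Prod>n<k. c n)" "0 \<le> c k"
    using Suc.prems by (auto intro!: prod_nonneg)
  ultimately show ?case
    using stretches_compose[OF _ step] by simp
qed

section \<open>The bounds\<close>

lemma mse_constant_le:
  fixes d :: real
  assumes "0 < d"
  shows "ln (exp (1 - 1 / d) / (2 * pi * exp 1)) \<le> ln (d / (2 * pi * exp 1))"
proof -
  have "ln (1 / d) \<le> 1 / d - 1" using assms by (intro ln_le_minus_one) simp
  then have "1 - 1 / d \<le> ln d" using assms by (simp add: ln_div)
  then show ?thesis using assms by (simp add: ln_div)
qed

theorem corollary2:
  fixes A :: "real^'m^'n" and b :: "real^'n"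
    and U :: "'m \<Rightarrow> real \<Rightarrow> real" and Umin Umax :: "'m \<Rightarrow> real"
    and \<mu> :: "nat \<Rightarrow> real" and \<mu>star :: real
    and qx :: "'m \<Rightarrow> 's quantizer" and ql :: "'n \<Rightarrow> 't quantizer"
    and P :: "'w measure"
    and x :: "nat \<Rightarrow> 'w \<Rightarrow> real^'m" and l :: "nat \<Rightarrow> 'w \<Rightarrow> real^'n"
    and px :: "real^'m \<Rightarrow> real" and pl :: "real^'n \<Rightarrow> real"
    and xstar :: "real^'m" and lstar :: "real^'n" and k :: nat
  assumes "CARD('n) < CARD('m)"
    and "\<And>i. concave_on UNIV (U i)"
    and "\<And>i. twice_continuously_differentiable (U i)"
    and "\<And>i t. Umin i \<le> deriv (deriv (U i)) t"
    and "\<And>i t. deriv (deriv (U i)) t \<le> Umax i"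
    and "\<And>i. Umax i < 0"
    and "\<And>n. 0 < \<mu> n"
    and "\<And>n. \<mu> n \<le> (MIN i. 1 / \<bar>Umin i\<bar>)"
    and "\<mu> \<longlonglongrightarrow> \<mu>star" and "0 < \<mu>star"
    and "primal_optimal A b U xstar" and "dual_optimal A b U lstar"
    and "\<And>i. valid_quantizer (qx i)" and "\<And>j. valid_quantizer (ql j)"
    and "prob_space P"
    and "information_space.finite_entropy P (exp 1) lborel (x 0) px"
    and "information_space.finite_entropy P (exp 1) lborel (l 0) pl"
    and "independent_vars P (x 0) (l 0)"
    and "\<And>\<omega>. \<omega> \<in> space P \<Longrightarrow>
           quantized_primal_dual A b U \<mu> qx ql (\<lambda>n. x n \<omega>) (\<lambda>n. l n \<omega>)"
  shows
    "ext_ln (\<integral>\<^sup>+\<omega>. ennreal ((norm (x k \<omega> - xstar))\<^sup>2) \<partial>P) \<ge>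
       ereal (ln (exp (1 - 1 / real CARD('m)) / (2 * pi * exp 1))) +
       ereal (2 / real CARD('m)) *
         ((\<Sum>i\<in>UNIV. \<Sum>n<k. ext_ln (ennreal (1 + \<mu> n * Umin i)))
          + ereal (prob_space.entropy P (exp 1) lborel (x 0))
          - ereal (\<Sum>t<k. \<Sum>j\<in>UNIV. ln (real (card (alphabet (ql j) t)))))
     \<and>
     ext_ln (\<integral>\<^sup>+\<omega>. ennreal ((norm (l k \<omega> - lstar))\<^sup>2) \<partial>P) \<ge>
       ereal (ln (exp (1 - 1 / real CARD('n)) / (2 * pi * exp 1)) +
         2 / real CARD('n) *
           (prob_space.entropy P (exp 1) lborel (l 0)
            - (\<Sum>t<k. \<Sum>i\<in>UNIV. ln (real (card (alphabet (qx i) t))))))"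
proof -
  interpret prob_space P by fact
  define hx where "hx = entropy (exp 1) lborel (x 0)"
  define hl where "hl = entropy (exp 1) lborel (l 0)"
  define Kl where "Kl = (\<Sum>t<k. \<Sum>j\<in>UNIV. ln (real (card (alphabet (ql j) t))))"
  define Kx where "Kx = (\<Sum>t<k. \<Sum>i\<in>UNIV. ln (real (card (alphabet (qx i) t))))"
  define G where "G i n = 1 + \<mu> n * Umin i" for i n
  have ql: "\<And>j. valid_quantizer (ql j)" and qx: "\<And>i. valid_quantizer (qx i)"
    and pd: "\<And>\<omega>. \<omega> \<in> space P \<Longrightarrow>
           quantized_primal_dual A b U \<mu> qx ql (\<lambda>n. x n \<omega>) (\<lambda>n. l n \<omega>)"
    and mu: "\<And>n. 0 < \<mu> n"
    by fact+
  have dU: "(deriv (U i) has_real_derivative deriv (deriv (U i)) t) (at t)"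
    and cU: "continuous_on UNIV (deriv (deriv (U i)))" for i t
    using assms(3)[of i]
    by (auto simp: twice_continuously_differentiable_def DERIV_deriv_iff_real_differentiable)
  have primal_traj: "\<exists>s\<in>words ql k. \<forall>i.
      x k \<omega> $ i = driven \<mu> (deriv (U i)) (\<lambda>n. column i A \<bullet> decoded ql s n) k (x 0 \<omega> $ i)"
    if \<omega>: "\<omega> \<in> space P" for \<omega>
  proof -
    obtain s where s: "s \<in> words ql k" and
      Q: "\<And>t. t < k \<Longrightarrow> (\<chi> j. quantized (ql j) (\<lambda>n. l n \<omega> $ j) t) = decoded ql s t"
      using quantized_eq_decoded_word[where q = ql and z = "\<lambda>n. l n \<omega>" and k = k, OF ql] by blast
    show ?thesis
    proof (intro bexI[OF _ s] allI)
      fix i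
      show "x k \<omega> $ i = driven \<mu> (deriv (U i)) (\<lambda>n. column i A \<bullet> decoded ql s n) k (x 0 \<omega> $ i)"
        using pd[OF \<omega>] Q
        by (intro driven_unique[where y = "\<lambda>n. x n \<omega> $ i"])
          (simp add: quantized_primal_dual_def Let_def)
    qed
  qed
  have dual_traj: "\<exists>s\<in>words qx k. \<forall>j.
      l k \<omega> $ j = driven \<mu> (\<lambda>_. 0) (\<lambda>n. b $ j - row j A \<bullet> decoded qx s n) k (l 0 \<omega> $ j)"
    if \<omega>: "\<omega> \<in> space P" for \<omega>
  proof -
    obtain s where s: "s \<in> words qx k" and
      Q: "\<And>t. t < k \<Longrightarrow> (\<chi> i. quantized (qx i) (\<lambda>n. x n \<omega> $ i) t) = decoded qx s t"
      using quantized_eq_decoded_word[where q = qx and z = "\<lambda>n. x n \<omega>" and k = k, OF qx] by blast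
    show ?thesis
    proof (intro bexI[OF _ s] allI)
      fix j
      show "l k \<omega> $ j = driven \<mu> (\<lambda>_. 0) (\<lambda>n. b $ j - row j A \<bullet> decoded qx s n) k (l 0 \<omega> $ j)"
        using pd[OF \<omega>] Q
        by (intro driven_unique[where y = "\<lambda>n. l n \<omega> $ j"])
          (simp add: quantized_primal_dual_def Let_def)
    qed
  qed
  have primal: "ereal (ln (exp (1 - 1 / real CARD('m)) / (2 * pi * exp 1))) +
      ereal (2 / real CARD('m)) *
        ((\<Sum>i\<in>UNIV. \<Sum>n<k. ext_ln (ennreal (G i n))) + ereal hx - ereal Kl)
      \<le> ext_ln (\<integral>\<^sup>+\<omega>. ennreal ((norm (x k \<omega> - xstar))\<^sup>2) \<partial>P)"
  proof (cases "\<forall>i. \<forall>n<k. 0 < G i n")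
    case True
    have "ereal (ln (real CARD('m) / (2 * pi * exp 1)) +
        2 / real CARD('m) * ((\<Sum>i\<in>UNIV. ln (\<Prod>n<k. G i n)) + hx - ln (real (card (words ql k)))))
      \<le> ext_ln (\<integral>\<^sup>+\<omega>. ennreal ((norm (x k \<omega> - xstar))\<^sup>2) \<partial>P)"
      unfolding hx_def
    proof (rule mse_lower_bound_of_finitely_many_maps)
      show "finite (words ql k)" by (rule finite_words[OF ql])
      show "\<exists>s\<in>words ql k. \<forall>i. x k \<omega> $ i =
          driven \<mu> (deriv (U i)) (\<lambda>n. column i A \<bullet> decoded ql s n) k (x 0 \<omega> $ i)"
        if "\<omega> \<in> space P" for \<omega> by (rule primal_traj[OF that])
      show "0 < (\<Prod>n<k. G i n)" for i using True by (auto intro!: prod_pos)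
      show "stretches (\<Prod>n<k. G i n)
          (driven \<mu> (deriv (U i)) (\<lambda>n. column i A \<bullet> decoded ql s n) k)" for s i
        using True mu assms(4)
        by (intro stretches_driven[OF dU cU]) (auto simp: G_def less_imp_le intro!: mult_left_mono)
    qed fact+
    moreover have "ln (\<Prod>n<k. G i n) = (\<Sum>n<k. ln (G i n))" for i
      using True by (auto simp: less_imp_neq[symmetric] intro!: ln_prod)
    moreover have "ext_ln (ennreal (G i n)) = ereal (ln (G i n))" if "n < k" for i n
    proof -
      have "0 < G i n" using True that by blast
      then show ?thesis by (simp add: ext_ln_def)
    qed
    ultimately show ?thesis
      using mse_constant_le[of "real CARD('m)"]
      by (auto simp: ln_card_words[OF ql] Kl_def elim!: order_trans[rotated])
  next
    case False
    then obtain i0 n0 where 0: "n0 < k" "G i0 n0 \<le> 0" by (auto simp: not_less)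
    have ninf: "ext_ln (ennreal r) \<noteq> \<infinity>" for r by (simp add: ext_ln_def)
    have "(\<Sum>n<k. ext_ln (ennreal (G i0 n))) = -\<infinity>"
      using 0 ninf by (intro sum_ereal_eq_MInfty[of _ n0]) (auto simp: ext_ln_def ennreal_neg)
    then have "(\<Sum>i\<in>UNIV. \<Sum>n<k. ext_ln (ennreal (G i n))) = -\<infinity>"
      using ninf by (intro sum_ereal_eq_MInfty[of _ i0]) (auto simp: sum_Pinfty)
    then show ?thesis by simp
  qed
  have "ereal (ln (real CARD('n) / (2 * pi * exp 1)) +
      2 / real CARD('n) * ((\<Sum>j\<in>(UNIV::'n set). ln 1) + hl - ln (real (card (words qx k)))))
    \<le> ext_ln (\<integral>\<^sup>+\<omega>. ennreal ((norm (l k \<omega> - lstar))\<^sup>2) \<partial>P)"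
    unfolding hl_def
  proof (rule mse_lower_bound_of_finitely_many_maps)
    show "finite (words qx k)" by (rule finite_words[OF qx])
    show "\<exists>s\<in>words qx k. \<forall>j. l k \<omega> $ j =
        driven \<mu> (\<lambda>_. 0) (\<lambda>n. b $ j - row j A \<bullet> decoded qx s n) k (l 0 \<omega> $ j)"
      if "\<omega> \<in> space P" for \<omega> by (rule dual_traj[OF that])
    show "stretches 1 (driven \<mu> (\<lambda>_. 0) (\<lambda>n. b $ j - row j A \<bullet> decoded qx s n) k)" for s j
      using stretches_driven[where v = "\<lambda>_. 0" and v' = "\<lambda>_. 0" and c = "\<lambda>_. 1" and k = k] by simp
  qed (fact | simp)+
  then have "ereal (ln (exp (1 - 1 / real CARD('n)) / (2 * pi * exp 1)) +
      2 / real CARD('n) * (hl - Kx))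
    \<le> ext_ln (\<integral>\<^sup>+\<omega>. ennreal ((norm (l k \<omega> - lstar))\<^sup>2) \<partial>P)"
    using mse_constant_le[of "real CARD('n)"]
    by (auto simp: ln_card_words[OF qx] Kx_def elim!: order_trans[rotated])
  with primal show ?thesis
    unfolding hx_def hl_def Kx_def Kl_def G_def by simp
qed

end
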